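(* Let $R$ be a commutative, associative, unital ring and let $N$ be an $R$-module. Then (1) every injective $R$-module is strongly $\text{Red}$-injective; (2) every $\text{Red}$-$N$-injective $R$-module is $\text{Soc}$-$N$-injective.
   Context: All modules are unital right $R$-modules. An $R$-module $M$ is reduced if for all $r\in R$ and $m\in M$, $mr^{2}=0$ implies $mr=0$; a submodule is reduced if it is reduced as a module. $\text{Red}(M)$ denotes the sum of all reduced submodules of $M$. A module $M$ is semi-reduced if $\text{Red}(M)=M$; a submodule is semi-reduced if it is so as a module. For $R$-modules $M$ and $N$, $M$ is $\text{Red}$-$N$-injective if for every semi-reduced submodule $K$ of $N$, every $R$-homomorphism $f:K\rightarrow M$ extends to an $R$-homomorphism $N\rightarrow M$. $M$ is strongly $\text{Red}$-injective if $M$ is $\text{Red}$-$N$-injective for all $R$-modules $N$. $\text{Soc}(N)$ is the sum of the simple submodules of $N$. $M$ is $\text{Soc}$-$N$-injective if every $R$-homomorphism $f:\text{Soc}(N)\rightarrow M$ extends to $N$. *)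

theory Defs
  imports "HOL-Algebra.Module"
begin

text \<open>
  The library's \<open>module\<close> locale is for modules over a commutative ring and writes scalars on the
  left; over such a ring, left and right modules coincide, and \<open>r \<odot> m\<close> stands for $mr$.
  A submodule \<open>K\<close> of \<open>M\<close> is regarded as a module through \<open>M\<lparr>carrier := K\<rparr>\<close>.
\<close>

definition module_hom ::
  "('a, 'r) ring_scheme \<Rightarrow> ('a, 'm, 'k) module_scheme \<Rightarrow> ('a, 'n, 'l) module_scheme \<Rightarrow> ('m \<Rightarrow> 'n) set"
  where
  "module_hom R M N = {f \<in> carrier M \<rightarrow> carrier N.
     (\<forall>x \<in> carrier M. \<forall>y \<in> carrier M. f (x \<oplus>\<^bsub>M\<^esub> y) = f x \<oplus>\<^bsub>N\<^esub> f y) \<and>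
     (\<forall>r \<in> carrier R. \<forall>x \<in> carrier M. f (r \<odot>\<^bsub>M\<^esub> x) = r \<odot>\<^bsub>N\<^esub> f x)}"

text \<open>
  The sum of a possibly infinite family of submodules consists of the finite sums of elements
  of its members; the sum of the empty family is the zero submodule.
\<close>

definition submodule_sum :: "('a, 'm, 'k) module_scheme \<Rightarrow> 'm set set \<Rightarrow> 'm set" where
  "submodule_sum M \<K> =
     {finsum M x F | x F. finite F \<and> F \<subseteq> \<K> \<and> (\<forall>K \<in> F. x K \<in> K)}"

definition reduced_module :: "('a, 'r) ring_scheme \<Rightarrow> ('a, 'm, 'k) module_scheme \<Rightarrow> bool" where
  "reduced_module R M \<longleftrightarrow>
     (\<forall>r \<in> carrier R. \<forall>m \<in> carrier M.
        (r [^]\<^bsub>R\<^esub> (2::nat)) \<odot>\<^bsub>M\<^esub> m = \<zero>\<^bsub>M\<^esub> \<longrightarrow> r \<odot>\<^bsub>M\<^esub> m = \<zero>\<^bsub>M\<^esub>)"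

definition Red :: "('a, 'r) ring_scheme \<Rightarrow> ('a, 'm, 'k) module_scheme \<Rightarrow> 'm set" where
  "Red R M = submodule_sum M {K. submodule K R M \<and> reduced_module R (M\<lparr>carrier := K\<rparr>)}"

definition semi_reduced_module :: "('a, 'r) ring_scheme \<Rightarrow> ('a, 'm, 'k) module_scheme \<Rightarrow> bool" where
  "semi_reduced_module R M \<longleftrightarrow> Red R M = carrier M"

definition simple_module :: "('a, 'r) ring_scheme \<Rightarrow> ('a, 'm, 'k) module_scheme \<Rightarrow> bool" where
  "simple_module R M \<longleftrightarrow>
     carrier M \<noteq> {\<zero>\<^bsub>M\<^esub>} \<and> (\<forall>K. submodule K R M \<longrightarrow> K = {\<zero>\<^bsub>M\<^esub>} \<or> K = carrier M)"

definition Soc :: "('a, 'r) ring_scheme \<Rightarrow> ('a, 'm, 'k) module_scheme \<Rightarrow> 'm set" where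
  "Soc R M = submodule_sum M {K. submodule K R M \<and> simple_module R (M\<lparr>carrier := K\<rparr>)}"

text \<open>Every homomorphism from the submodule \<open>K\<close> of \<open>N\<close> to \<open>M\<close> extends to \<open>N\<close>.\<close>

definition homs_extend ::
  "('a, 'r) ring_scheme \<Rightarrow> 'n set \<Rightarrow> ('a, 'n, 'l) module_scheme \<Rightarrow> ('a, 'm, 'k) module_scheme \<Rightarrow> bool"
  where
  "homs_extend R K N M \<longleftrightarrow>
     (\<forall>f \<in> module_hom R (N\<lparr>carrier := K\<rparr>) M. \<exists>g \<in> module_hom R N M. \<forall>x \<in> K. g x = f x)"

definition Red_injective ::
  "('a, 'r) ring_scheme \<Rightarrow> ('a, 'n, 'l) module_scheme \<Rightarrow> ('a, 'm, 'k) module_scheme \<Rightarrow> bool" where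
  "Red_injective R N M \<longleftrightarrow>
     (\<forall>K. submodule K R N \<and> semi_reduced_module R (N\<lparr>carrier := K\<rparr>) \<longrightarrow> homs_extend R K N M)"

definition Soc_injective ::
  "('a, 'r) ring_scheme \<Rightarrow> ('a, 'n, 'l) module_scheme \<Rightarrow> ('a, 'm, 'k) module_scheme \<Rightarrow> bool" where
  "Soc_injective R N M \<longleftrightarrow> homs_extend R (Soc R N) N M"

text \<open>
  A formula of HOL cannot quantify over types, so the type \<open>'u\<close> of the elements of the test
  modules, the analogue of a universe, is a parameter of the two notions that quantify over
  all modules.
\<close>

definition injective_module ::
  "'u itself \<Rightarrow> ('a, 'r) ring_scheme \<Rightarrow> ('a, 'm, 'k) module_scheme \<Rightarrow> bool" where
  "injective_module U R M \<longleftrightarrow>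
     (\<forall>N :: ('a, 'u) module. module R N \<longrightarrow> (\<forall>K. submodule K R N \<longrightarrow> homs_extend R K N M))"

definition strongly_Red_injective ::
  "'u itself \<Rightarrow> ('a, 'r) ring_scheme \<Rightarrow> ('a, 'm, 'k) module_scheme \<Rightarrow> bool" where
  "strongly_Red_injective U R M \<longleftrightarrow>
     (\<forall>N :: ('a, 'u) module. module R N \<longrightarrow> Red_injective R N M)"

end

theory Submission
  imports Defs
begin

text \<open>
  Injectivity asks for the extension of homomorphisms from every submodule, so (1) is immediate.
  For (2), let \<open>S\<close> be a simple module and \<open>r \<in> R\<close>. The annihilator of \<open>r\<close> in \<open>S\<close> is a submodule,
  hence it is \<open>0\<close> or \<open>S\<close>, and in both cases \<open>r\<^sup>2 m = 0\<close> implies \<open>r m = 0\<close>: simple modules are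
  reduced. The socle is therefore a sum of reduced submodules, i.e. a semi-reduced submodule.
\<close>

context module
begin

lemma submodule_finsum_closed:
  assumes "submodule H R M" "finite F" "x \<in> F \<rightarrow> H"
  shows "finsum M x F \<in> H"
  using assms(2,3)
proof (induction F rule: finite_induct)
  case empty
  show ?case
    using submodule.axioms(1)[OF assms(1)] subgroup.one_closed by fastforce
next
  case (insert K F)
  then show ?case
    using submoduleE(1,5)[OF assms(1)] by (subst M.finsum_insert) auto
qed

text \<open>\<open>finsum\<close> folds inside the carrier of its structure, so shrinking the
  carrier is not harmless by definition. For terms in \<open>H\<close> both folds obey the same
  recursion, since addition and zero are shared.\<close>

lemma finsum_submodule:
  assumes "submodule H R M" "finite F" "x \<in> F \<rightarrow> H"
  shows "finsum (M\<lparr>carrier := H\<rparr>) x F = finsum M x F"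
proof -
  interpret H: module R "M\<lparr>carrier := H\<rparr>"
    using submodule.submodule_is_module[OF assms(1)] module_axioms .
  show ?thesis
    using assms(2,3)
  proof (induction F rule: finite_induct)
    case empty
    then show ?case by simp
  next
    case (insert K F)
    then show ?case
      using submoduleE(1)[OF assms(1)] by (subst H.finsum_insert, auto, subst M.finsum_insert) auto
  qed
qed

text \<open>Restricting the carrier first to \<open>H\<close> and then to \<open>K\<close> gives the
  same structure as restricting to \<open>K\<close> at once, so being a module does not depend on
  the ambient module chosen.\<close>

lemma submodule_of_submodule_iff:
  assumes "submodule H R M"
  shows "submodule K R (M\<lparr>carrier := H\<rparr>) \<longleftrightarrow> submodule K R M \<and> K \<subseteq> H"
proof -
  interpret H: module R "M\<lparr>carrier := H\<rparr>"
    using submodule.submodule_is_module[OF assms] module_axioms .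
  show ?thesis
  proof
    assume K: "submodule K R (M\<lparr>carrier := H\<rparr>)"
    then have "module R (M\<lparr>carrier := K\<rparr>)"
      using submodule.submodule_is_module[OF K H.module_axioms] by simp
    with H.submoduleE(1)[OF K] submoduleE(1)[OF assms]
    show "submodule K R M \<and> K \<subseteq> H"
      by (auto intro: module_incl_imp_submodule)
  next
    assume K: "submodule K R M \<and> K \<subseteq> H"
    then have "module R (M\<lparr>carrier := H\<rparr>\<lparr>carrier := K\<rparr>)"
      using submodule.submodule_is_module[of K R M] module_axioms by simp
    with K show "submodule K R (M\<lparr>carrier := H\<rparr>)"
      by (intro H.module_incl_imp_submodule) simp_all
  qed
qed

lemma submodule_zero: "submodule H R M \<Longrightarrow> \<zero>\<^bsub>M\<^esub> \<in> H"
  using submodule_finsum_closed[of H "{}"] by simp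

lemma submodule_submodule_sum:
  assumes \<K>: "\<And>K. K \<in> \<K> \<Longrightarrow> submodule K R M"
  shows "submodule (submodule_sum M \<K>) R M"
proof (rule submoduleI)
  have carr: "x \<in> F \<rightarrow> carrier M" if "F \<subseteq> \<K>" "\<forall>K\<in>F. x K \<in> K" for F x
    using that submoduleE(1)[OF \<K>] by blast
  show "submodule_sum M \<K> \<subseteq> carrier M"
    unfolding submodule_sum_def using carr by auto
  show "\<zero>\<^bsub>M\<^esub> \<in> submodule_sum M \<K>"
    unfolding submodule_sum_def by (force intro: exI[of _ "{}"])
  have smult: "r \<odot>\<^bsub>M\<^esub> a \<in> submodule_sum M \<K>"
    if "r \<in> carrier R" "a \<in> submodule_sum M \<K>" for r a
  proof -
    from that(2) obtain x F where F: "a = finsum M x F" "finite F" "F \<subseteq> \<K>" "\<forall>K\<in>F. x K \<in> K"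
      unfolding submodule_sum_def by blast
    then have "r \<odot>\<^bsub>M\<^esub> a = finsum M (\<lambda>K. r \<odot>\<^bsub>M\<^esub> x K) F"
      using finsum_smult_ldistr[OF F(2) that(1) carr] by simp
    moreover have "\<forall>K\<in>F. r \<odot>\<^bsub>M\<^esub> x K \<in> K"
      using F submoduleE(4)[OF \<K>] that(1) by blast
    ultimately show ?thesis
      unfolding submodule_sum_def using F by blast
  qed
  then show "r \<odot>\<^bsub>M\<^esub> a \<in> submodule_sum M \<K>"
    if "r \<in> carrier R" "a \<in> submodule_sum M \<K>" for r a
    using that .
  show "\<ominus>\<^bsub>M\<^esub> a \<in> submodule_sum M \<K>" if "a \<in> submodule_sum M \<K>" for a
  proof -
    have "a \<in> carrier M"
      using that \<open>submodule_sum M \<K> \<subseteq> carrier M\<close> by blast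
    \<comment> \<open>The negative of \<open>a\<close> is its multiple by
      \<open>\<ominus> \<one>\<close>, so closure under scalars suffices.\<close>
    then show ?thesis
      using smult[of "\<ominus> \<one>" a] that smult_l_minus[of \<one> a] by simp
  qed
  show "a \<oplus>\<^bsub>M\<^esub> b \<in> submodule_sum M \<K>"
    if ab: "a \<in> submodule_sum M \<K>" "b \<in> submodule_sum M \<K>" for a b
  proof -
    from ab(1) obtain x F where F: "a = finsum M x F" "finite F" "F \<subseteq> \<K>" "\<forall>K\<in>F. x K \<in> K"
      unfolding submodule_sum_def by blast
    from ab(2) obtain y G where G: "b = finsum M y G" "finite G" "G \<subseteq> \<K>" "\<forall>K\<in>G. y K \<in> K"
      unfolding submodule_sum_def by blast
    \<comment> \<open>A submodule may lie in both \<open>F\<close> and \<open>G\<close>, but a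
      family holds one term per submodule. Extending both families by zero to
      \<open>F \<union> G\<close> allows termwise addition.\<close>
    define x' where "x' K = (if K \<in> F then x K else \<zero>\<^bsub>M\<^esub>)" for K
    define y' where "y' K = (if K \<in> G then y K else \<zero>\<^bsub>M\<^esub>)" for K
    have x': "x' K \<in> K" and y': "y' K \<in> K" if "K \<in> F \<union> G" for K
      using that F G submodule_zero[OF \<K>] unfolding x'_def y'_def by auto
    then have carr': "x' \<in> F \<union> G \<rightarrow> carrier M" "y' \<in> F \<union> G \<rightarrow> carrier M"
      using carr[of "F \<union> G"] F(3) G(3) by auto
    have "finsum M x F = finsum M x' (F \<union> G)"
      by (rule M.add.finprod_mono_neutral_cong_left)
        (use F G carr' in \<open>auto simp: x'_def\<close>)
    moreover have "finsum M y G = finsum M y' (F \<union> G)"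
      by (rule M.add.finprod_mono_neutral_cong_left)
        (use F G carr' in \<open>auto simp: y'_def\<close>)
    ultimately have "a \<oplus>\<^bsub>M\<^esub> b = finsum M (\<lambda>K. x' K \<oplus>\<^bsub>M\<^esub> y' K) (F \<union> G)"
      using F(1) G(1) M.finsum_addf[OF carr'] by simp
    moreover have "\<forall>K\<in>F \<union> G. x' K \<oplus>\<^bsub>M\<^esub> y' K \<in> K"
      using x' y' submoduleE(5)[OF \<K>] F(3) G(3) by blast
    ultimately show ?thesis
      unfolding submodule_sum_def using F(2,3) G(2,3) by (blast intro: finite_UnI)
  qed
qed

lemma subset_submodule_sum:
  assumes "submodule K R M" "K \<in> \<K>"
  shows "K \<subseteq> submodule_sum M \<K>"
proof
  fix a
  assume "a \<in> K"
  then have "a \<in> carrier M"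
    using submoduleE(1)[OF assms(1)] by blast
  then have "a = finsum M (\<lambda>_. a) {K}"
    by simp
  with \<open>a \<in> K\<close> assms(2) show "a \<in> submodule_sum M \<K>"
    unfolding submodule_sum_def by (blast intro: finite.intros)
qed

lemma submodule_sum_mono_submodules:
  assumes "\<K> \<subseteq> \<L>"
  shows "submodule_sum M \<K> \<subseteq> submodule_sum M \<L>"
  unfolding submodule_sum_def using assms by blast

text \<open>This allows the socle of \<open>M\<close> to be recomputed as a sum taken inside the
  socle itself.\<close>

lemma submodule_sum_submodule:
  assumes "submodule H R M" "\<And>K. K \<in> \<K> \<Longrightarrow> K \<subseteq> H"
  shows "submodule_sum (M\<lparr>carrier := H\<rparr>) \<K> = submodule_sum M \<K>"
proof -
  have "finsum (M\<lparr>carrier := H\<rparr>) x F = finsum M x F"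
    if "finite F" "F \<subseteq> \<K>" "\<forall>K\<in>F. x K \<in> K" for x F
    using assms(2) that by (intro finsum_submodule[OF assms(1)] Pi_I) auto
  then show ?thesis
    unfolding submodule_sum_def by (intro Collect_cong ex_cong1) auto
qed

lemma annihilator_submodule:
  assumes "r \<in> carrier R"
  shows "submodule {x \<in> carrier M. r \<odot>\<^bsub>M\<^esub> x = \<zero>\<^bsub>M\<^esub>} R M"
proof (rule submoduleI)
  fix a x
  assume "a \<in> carrier R" "x \<in> {x \<in> carrier M. r \<odot>\<^bsub>M\<^esub> x = \<zero>\<^bsub>M\<^esub>}"
  then show "a \<odot>\<^bsub>M\<^esub> x \<in> {x \<in> carrier M. r \<odot>\<^bsub>M\<^esub> x = \<zero>\<^bsub>M\<^esub>}"
    \<comment> \<open>Commutativity of \<open>R\<close> enters here: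
      \<open>r(ax) = (ra)x = (ar)x = a(rx) = 0\<close>.\<close>
    using assms by (auto simp flip: smult_assoc1) (simp add: R.m_comm smult_assoc1)
qed (use assms in \<open>auto simp: smult_r_distr smult_r_minus\<close>)

lemma simple_imp_reduced:
  assumes "simple_module R M"
  shows "reduced_module R M"
  unfolding reduced_module_def
proof (intro ballI impI)
  fix r m
  assume r: "r \<in> carrier R" and m: "m \<in> carrier M"
    and "(r [^] (2::nat)) \<odot>\<^bsub>M\<^esub> m = \<zero>\<^bsub>M\<^esub>"
  then have rrm: "r \<odot>\<^bsub>M\<^esub> (r \<odot>\<^bsub>M\<^esub> m) = \<zero>\<^bsub>M\<^esub>"
    by (simp add: numeral_2_eq_2 smult_assoc1)
  let ?A = "{x \<in> carrier M. r \<odot>\<^bsub>M\<^esub> x = \<zero>\<^bsub>M\<^esub>}"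
  have "?A = {\<zero>\<^bsub>M\<^esub>} \<or> ?A = carrier M"
    using assms annihilator_submodule[OF r] unfolding simple_module_def by blast
  \<comment> \<open>If \<open>?A\<close> is zero, this membership gives the claim; if
    \<open>?A\<close> is everything, \<open>m\<close> itself lies in it.\<close>
  moreover have "r \<odot>\<^bsub>M\<^esub> m \<in> ?A"
    using r m rrm by simp
  ultimately show "r \<odot>\<^bsub>M\<^esub> m = \<zero>\<^bsub>M\<^esub>"
    using m by blast
qed

lemma Soc_submodule: "submodule (Soc R M) R M"
  unfolding Soc_def by (rule submodule_submodule_sum) simp

text \<open>\<open>Red\<close> has to be computed with the socle as ambient module. Each simple
  submodule of \<open>M\<close> lies in the socle, so it is also a reduced submodule there.\<close>

lemma Soc_semi_reduced: "semi_reduced_module R (M\<lparr>carrier := Soc R M\<rparr>)"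
proof -
  let ?S = "M\<lparr>carrier := Soc R M\<rparr>"
  let ?\<K> = "{K. submodule K R M \<and> simple_module R (M\<lparr>carrier := K\<rparr>)}"
  let ?\<L> = "{K. submodule K R ?S \<and> reduced_module R (?S\<lparr>carrier := K\<rparr>)}"
  interpret S: module R ?S
    using submodule.submodule_is_module[OF Soc_submodule] module_axioms .
  have sub: "K \<subseteq> Soc R M" if "K \<in> ?\<K>" for K
    unfolding Soc_def using that by (intro subset_submodule_sum) auto
  have "K \<in> ?\<L>" if "K \<in> ?\<K>" for K
    using that sub[OF that] submodule_of_submodule_iff[OF Soc_submodule]
      module.simple_imp_reduced[OF submodule.submodule_is_module[OF _ module_axioms]]
    by simp
  \<comment> \<open>The socle is squeezed: as the sum of \<open>?\<K>\<close> taken in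
    \<open>?S\<close> it lies in \<open>Red R ?S\<close>, which in turn lies in the carrier of
    \<open>?S\<close>, the socle again.\<close>
  then have "submodule_sum ?S ?\<K> \<subseteq> Red R ?S"
    unfolding Red_def by (intro S.submodule_sum_mono_submodules) blast
  moreover have "submodule_sum ?S ?\<K> = Soc R M"
    using submodule_sum_submodule[OF Soc_submodule, of ?\<K>] sub by (simp flip: Soc_def)
  moreover have "Red R ?S \<subseteq> carrier ?S"
    unfolding Red_def by (intro S.submoduleE(1) S.submodule_submodule_sum) simp
  ultimately show ?thesis
    unfolding semi_reduced_module_def by simp
qed

end

theorem proposition3:
  fixes R :: "('a, 'r) ring_scheme" and N :: "('a, 'n, 'l) module_scheme"
  assumes "cring R" and "module R N"
  shows "(\<forall>M :: ('a, 'm, 'k) module_scheme.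
            module R M \<and> injective_module TYPE('u) R M \<longrightarrow> strongly_Red_injective TYPE('u) R M) \<and>
         (\<forall>M :: ('a, 'm, 'k) module_scheme.
            module R M \<and> Red_injective R N M \<longrightarrow> Soc_injective R N M)"
  \<comment> \<open>For (2), the semi-reduced submodule to extend from is
    \<open>Soc R N\<close>.\<close>
  using module.Soc_submodule[OF assms(2)] module.Soc_semi_reduced[OF assms(2)]
  unfolding injective_module_def strongly_Red_injective_def Red_injective_def Soc_injective_def
  by blast

end
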